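(* Let $G$ and $H$ be finite simple connected graphs. If the strong product $G\boxtimes H$ is a DMR graph, then both $G$ and $H$ are DMR graphs.
   Context: All graphs are finite, simple and connected. $\Gamma_i(u)$ is the set of vertices at distance exactly $i$ from $u$. A graph $G$ is DMR (distance mean-regular) if for all $0\le h,i,j\le\operatorname{diam}(G)$ the average $\frac{1}{|\Gamma_h(u)|}\sum_{v\in\Gamma_h(u)}|\Gamma_i(u)\cap\Gamma_j(v)|$ depends only on $h,i,j$ and not on the vertex $u$. The strong product $G\boxtimes H$ has vertex set $V(G)\times V(H)$, and $(g_1,h_1)\sim(g_2,h_2)$ iff ($g_1\sim g_2$ and $h_1=h_2$) or ($g_1=g_2$ and $h_1\sim h_2$) or ($g_1\sim g_2$ and $h_1\sim h_2$). *)

theory Defs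
  imports "Graph_Theory.Graph_Theory"
begin

text \<open>
  A finite simple undirected graph is a \<open>pair_graph\<close>: a finite vertex set \<open>pverts G\<close> and an
  irreflexive symmetric set of arcs \<open>parcs G\<close>, where an edge is represented by its two
  opposite arcs.  The connectedness of \<open>Digraph_Component\<close> excludes the empty graph.
\<close>

text \<open>
  The distance is the weighted distance for unit arc weights.  It is extended-real
  valued; in a finite connected graph all its values are natural numbers, hence so is \<open>diam\<close>.
\<close>

definition gdist :: "'a pair_pre_digraph \<Rightarrow> 'a \<Rightarrow> 'a \<Rightarrow> ereal" where
  "gdist G u v = wf_digraph.\<mu> (with_proj G) (\<lambda>_. 1) u v"

definition diam :: "'a pair_pre_digraph \<Rightarrow> ereal" where
  "diam G = (SUP u\<in>pverts G. SUP v\<in>pverts G. gdist G u v)"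

definition Gam :: "'a pair_pre_digraph \<Rightarrow> nat \<Rightarrow> 'a \<Rightarrow> 'a set" where
  "Gam G i u = {v \<in> pverts G. gdist G u v = ereal (real i)}"

definition mean_intersection ::
    "'a pair_pre_digraph \<Rightarrow> nat \<Rightarrow> nat \<Rightarrow> nat \<Rightarrow> 'a \<Rightarrow> real" where
  "mean_intersection G h i j u =
     (\<Sum>v\<in>Gam G h u. real (card (Gam G i u \<inter> Gam G j v))) / real (card (Gam G h u))"

text \<open>
  If \<open>Gam G h u\<close> is empty, the mean is \<open>0 / 0 = 0\<close>.  This convention is immaterial: the case
  \<open>h = 0\<close>, \<open>i = j\<close> already makes \<open>card (Gam G i u)\<close> independent of \<open>u\<close>, so in a graph
  satisfying the condition no \<open>Gam G h u\<close> with \<open>h \<le> diam G\<close> is empty.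
\<close>

definition dmr :: "'a pair_pre_digraph \<Rightarrow> bool" where
  "dmr G \<longleftrightarrow> (\<forall>h i j :: nat.
     ereal (real h) \<le> diam G \<longrightarrow> ereal (real i) \<le> diam G \<longrightarrow> ereal (real j) \<le> diam G \<longrightarrow>
     (\<forall>u\<in>pverts G. \<forall>v\<in>pverts G. mean_intersection G h i j u = mean_intersection G h i j v))"

definition strong_product ::
    "'a pair_pre_digraph \<Rightarrow> 'b pair_pre_digraph \<Rightarrow> ('a \<times> 'b) pair_pre_digraph" where
  "strong_product G H =
     \<lparr> pverts = pverts G \<times> pverts H,
       parcs = {((g1, h1), (g2, h2)) | g1 h1 g2 h2.
         g1 \<in> pverts G \<and> g2 \<in> pverts G \<and> h1 \<in> pverts H \<and> h2 \<in> pverts H \<and>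
         ((g1, g2) \<in> parcs G \<and> h1 = h2 \<or>
          g1 = g2 \<and> (h1, h2) \<in> parcs H \<or>
          (g1, g2) \<in> parcs G \<and> (h1, h2) \<in> parcs H)} \<rparr>"

lemma pair_graph_strong_product:
  assumes "pair_graph G" "pair_graph H"
  shows "pair_graph (strong_product G H)"
proof -
  interpret G: pair_graph G by fact
  interpret H: pair_graph H by fact
  have fin: "finite (pverts G \<times> pverts H)"
    using G.pair_finite_verts H.pair_finite_verts by simp
  have "parcs (strong_product G H) \<subseteq> (pverts G \<times> pverts H) \<times> (pverts G \<times> pverts H)"
    by (auto simp: strong_product_def)
  then have "finite (parcs (strong_product G H))"
    using fin finite_subset by blast
  moreover have "finite (pverts (strong_product G H))"
    using fin by (simp add: strong_product_def)
  moreover have "fst e \<in> pverts (strong_product G H)" "snd e \<in> pverts (strong_product G H)"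
    if "e \<in> parcs (strong_product G H)" for e
    using that by (auto simp: strong_product_def)
  moreover have "fst e \<noteq> snd e" if "e \<in> parcs (strong_product G H)" for e
    using that G.pair_no_loops H.pair_no_loops by (fastforce simp: strong_product_def)
  moreover have "symmetric (with_proj (strong_product G H))"
  proof -
    have "(b, a) \<in> parcs G" if "(a, b) \<in> parcs G" for a b
      using that G.pair_sym_arcs by (auto simp: symmetric_def dest: symD)
    moreover have "(b, a) \<in> parcs H" if "(a, b) \<in> parcs H" for a b
      using that H.pair_sym_arcs by (auto simp: symmetric_def dest: symD)
    ultimately show ?thesis
      by (auto simp: strong_product_def symmetric_def intro!: symI)
  qed
  ultimately show ?thesis
    by unfold_locales
qed

lemma connected_strong_product:
  assumes "pair_graph G" "Digraph_Component.connected (with_proj G)"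
    and "pair_graph H" "Digraph_Component.connected (with_proj H)"
  shows "Digraph_Component.connected (with_proj (strong_product G H))"
proof -
  interpret G: pair_graph G by fact
  interpret H: pair_graph H by fact
  let ?P = "strong_product G H"
  interpret P: pair_graph ?P using assms pair_graph_strong_product by blast
  have sG: "strongly_connected (with_proj G)"
    by (rule G.symmetric_connected_imp_strongly_connected[OF G.pair_sym_arcs assms(2)])
  have sH: "strongly_connected (with_proj H)"
    by (rule H.symmetric_connected_imp_strongly_connected[OF H.pair_sym_arcs assms(4)])
  have left: "(a, h) \<rightarrow>\<^sup>*\<^bsub>with_proj ?P\<^esub> (b, h)"
    if "a \<rightarrow>\<^sup>*\<^bsub>with_proj G\<^esub> b" and h: "h \<in> pverts H" for a b h
    using that(1)
  proof (induct rule: G.reachable_induct)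
    case base
    then show ?case using h by (intro P.reachable_refl) (simp add: strong_product_def)
  next
    case (step x y)
    then have "((x, h), (y, h)) \<in> parcs ?P"
      using h by (auto simp: strong_product_def dest: G.in_arcsD1 G.in_arcsD2)
    with step(3) show ?case by (rule P.reachable_adj_trans)
  qed
  have right: "(g, a) \<rightarrow>\<^sup>*\<^bsub>with_proj ?P\<^esub> (g, b)"
    if "a \<rightarrow>\<^sup>*\<^bsub>with_proj H\<^esub> b" and g: "g \<in> pverts G" for a b g
    using that(1)
  proof (induct rule: H.reachable_induct)
    case base
    then show ?case using g by (intro P.reachable_refl) (simp add: strong_product_def)
  next
    case (step x y)
    then have "((g, x), (g, y)) \<in> parcs ?P"
      using g by (auto simp: strong_product_def dest: H.in_arcsD1 H.in_arcsD2)
    with step(3) show ?case by (rule P.reachable_adj_trans)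
  qed
  have reach: "(g1, h1) \<rightarrow>\<^sup>*\<^bsub>with_proj ?P\<^esub> (g2, h2)"
    if "g1 \<in> pverts G" "g2 \<in> pverts G" "h1 \<in> pverts H" "h2 \<in> pverts H" for g1 g2 h1 h2
  proof -
    have "(g1, h1) \<rightarrow>\<^sup>*\<^bsub>with_proj ?P\<^esub> (g2, h1)"
      using that sG by (intro left) (auto simp: strongly_connected_def)
    also have "(g2, h1) \<rightarrow>\<^sup>*\<^bsub>with_proj ?P\<^esub> (g2, h2)"
      using that sH by (intro right) (auto simp: strongly_connected_def)
    finally (P.reachable_trans) show ?thesis .
  qed
  have verts: "pverts ?P = pverts G \<times> pverts H"
    by (simp add: strong_product_def)
  have "pverts ?P \<noteq> {}"
    using sG sH by (simp add: verts strongly_connected_def)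
  moreover have "x \<rightarrow>\<^sup>*\<^bsub>mk_symmetric (with_proj ?P)\<^esub> y"
    if "x \<in> pverts ?P" "y \<in> pverts ?P" for x y
  proof (rule P.reachable_mk_symmetricI)
    show "x \<rightarrow>\<^sup>*\<^bsub>with_proj ?P\<^esub> y"
      using that by (auto simp: verts intro!: reach)
  qed
  ultimately show ?thesis
    unfolding Digraph_Component.connected_def strongly_connected_def by simp
qed

end

theory Submission
  imports Defs
begin

text \<open>
  Distance in the strong product is the maximum of the two coordinate distances, so a ball of the
  product is the product of two balls of the same radius, whereas a sphere of radius \<open>n\<close> consists of
  the pairs with one coordinate at distance exactly \<open>n\<close> and the other at distance at most \<open>n\<close>.
  The proof therefore trades spheres for balls.

  A graph is DMR iff, for all radii \<open>h\<close>, \<open>i\<close>, \<open>j\<close>, the number \<open>sphere_pairs\<close> of pairs \<open>(v, w)\<close> with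
  \<open>d(u, v) = h\<close>, \<open>d(u, w) = i\<close>, \<open>d(v, w) = j\<close> does not depend on \<open>u\<close>: the means for \<open>h = 0\<close>,
  \<open>i = j\<close> are the sphere sizes, which turns means into sums, and radii beyond the diameter only
  contribute zeros (\<open>dmr_iff_sphere_pairs\<close>).  Allowing all radii means that the diameters of the
  graphs never have to be compared.  Replacing the three equations by inequalities gives the number
  \<open>ball_pairs\<close>, which is the cumulative sum of \<open>sphere_pairs\<close> in the three radii.  Cumulative sums
  determine their summands, so \<open>ball_pairs\<close> is independent of \<open>u\<close> iff \<open>sphere_pairs\<close> is
  (\<open>dmr_iff_ball_pairs\<close>).

  For balls the count is multiplicative: the value for \<open>G \<boxtimes> H\<close> at \<open>(g, x)\<close> is the value for \<open>G\<close> at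
  \<open>g\<close> times the value for \<open>H\<close> at \<open>x\<close> (\<open>ball_pairs_strong_product\<close>).  Both factors are positive,
  because \<open>v = w = u\<close> is always counted.  Hence, if the product does not depend on \<open>(g, x)\<close>,
  fixing one coordinate and cancelling its factor shows that neither factor depends on its vertex.
\<close>

section \<open>Distance as a power of the closed adjacency relation\<close>

text \<open>
  Adding a loop at every vertex turns ``there is a walk of length at most \<open>n\<close>'' into membership in
  the \<open>n\<close>-th relational power, and turns the threefold case distinction in the strong product into
  a plain product of relations.
\<close>

definition closed_adj :: "'a pair_pre_digraph \<Rightarrow> 'a rel" where
  "closed_adj G = parcs G \<union> Id_on (pverts G)"

context pair_wf_digraph begin

lemma awalk_cost_one: "awalk_cost (\<lambda>_. 1) p = real (length p)"
  by (induct p) auto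

lemma awalk_imp_closed_adj_power:
  "awalk u p v \<Longrightarrow> length p \<le> n \<Longrightarrow> (u, v) \<in> closed_adj G ^^ n"
proof (induct n arbitrary: u p)
  case 0
  then show ?case by (simp add: awalk_Nil_iff)
next
  case (Suc n)
  show ?case
  proof (cases p)
    case Nil
    then have "(u, u) \<in> closed_adj G"
      using Suc.prems by (auto simp: awalk_Nil_iff closed_adj_def)
    moreover have "(u, v) \<in> closed_adj G ^^ n"
      using Suc.hyps[of u "[]"] Suc.prems Nil by simp
    ultimately show ?thesis by (rule relpow_Suc_I2)
  next
    case (Cons e q)
    then have "(u, snd e) \<in> closed_adj G"
      using Suc.prems by (auto simp: awalk_Cons_iff closed_adj_def)
    moreover have "(snd e, v) \<in> closed_adj G ^^ n"
      using Suc.hyps[of "snd e" q] Suc.prems Cons by (simp add: awalk_Cons_iff)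
    ultimately show ?thesis by (rule relpow_Suc_I2)
  qed
qed

lemma closed_adj_power_imp_awalk:
  "(u, v) \<in> closed_adj G ^^ n \<Longrightarrow> u \<in> pverts G \<Longrightarrow> \<exists>p. awalk u p v \<and> length p \<le> n"
proof (induct n arbitrary: u)
  case 0
  then show ?case by (intro exI[of _ "[]"]) (simp add: awalk_Nil_iff)
next
  case (Suc n)
  then obtain t where t: "(u, t) \<in> closed_adj G" "(t, v) \<in> closed_adj G ^^ n"
    by (meson relpow_Suc_D2)
  then have "t \<in> pverts G" by (auto simp: closed_adj_def dest: in_arcsD2)
  with t Suc obtain p where p: "awalk t p v" "length p \<le> n" by blast
  show ?case
  proof (cases "u = t")
    case True
    with p show ?thesis by (meson le_SucI)
  next
    case False
    with t have "(u, t) \<in> parcs G" by (auto simp: closed_adj_def)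
    with p show ?thesis
      by (intro exI[of _ "(u, t) # p"]) (auto simp: awalk_Cons_iff dest: in_arcsD1)
  qed
qed

text \<open>The infimum over walks is attained, because lengths of walks are natural numbers.\<close>

lemma gdist_eq_Least:
  assumes "awalk u p v"
  shows "gdist G u v = ereal (real (LEAST n. \<exists>p. awalk u p v \<and> length p = n))"
    (is "_ = ereal (real ?m)")
proof -
  obtain q where q: "awalk u q v" "length q = ?m"
    using LeastI_ex[of "\<lambda>n. \<exists>p. awalk u p v \<and> length p = n"] assms by blast
  have "(INF p\<in>{p. awalk u p v}. ereal (awalk_cost (\<lambda>_. 1) p)) = ereal (real ?m)"
  proof (rule antisym)
    show "(INF p\<in>{p. awalk u p v}. ereal (awalk_cost (\<lambda>_. 1) p)) \<le> ereal (real ?m)"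
      using q by (intro INF_lower2[of q]) (auto simp: awalk_cost_one)
    show "ereal (real ?m) \<le> (INF p\<in>{p. awalk u p v}. ereal (awalk_cost (\<lambda>_. 1) p))"
      by (rule INF_greatest) (auto simp: awalk_cost_one intro: Least_le)
  qed
  then show ?thesis by (simp add: gdist_def \<mu>_def)
qed

lemma gdist_finite_imp_attained:
  assumes "gdist G u v \<le> ereal r"
  obtains p where "awalk u p v" "gdist G u v = ereal (real (length p))"
proof -
  have "u \<rightarrow>\<^sup>*\<^bsub>G\<^esub> v"
    using assms shortest_path_inf[of u v "\<lambda>_. 1"]
    by (cases "u \<rightarrow>\<^sup>*\<^bsub>G\<^esub> v") (auto simp: gdist_def)
  then obtain p0 where p0: "awalk u p0 v"
    by (auto simp: reachable_awalk)
  then obtain p where "awalk u p v" "length p = (LEAST n. \<exists>p. awalk u p v \<and> length p = n)"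
    using LeastI_ex[of "\<lambda>n. \<exists>p. awalk u p v \<and> length p = n"] by blast
  with gdist_eq_Least[OF p0] that show thesis by simp
qed

lemma gdist_le_imp_nat:
  assumes "gdist G u v \<le> ereal (real n)"
  obtains k where "k \<le> n" "gdist G u v = ereal (real k)"
proof -
  obtain p where "awalk u p v" "gdist G u v = ereal (real (length p))"
    using assms by (rule gdist_finite_imp_attained)
  with assms show thesis by (intro that[of "length p"]) simp_all
qed

lemma gdist_le_iff_closed_adj_power:
  assumes "u \<in> pverts G"
  shows "gdist G u v \<le> ereal (real n) \<longleftrightarrow> (u, v) \<in> closed_adj G ^^ n"
proof
  assume le: "gdist G u v \<le> ereal (real n)"
  then obtain p where "awalk u p v" "gdist G u v = ereal (real (length p))"
    by (rule gdist_finite_imp_attained)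
  with le show "(u, v) \<in> closed_adj G ^^ n"
    by (auto intro: awalk_imp_closed_adj_power)
next
  assume "(u, v) \<in> closed_adj G ^^ n"
  then obtain p where p: "awalk u p v" "length p \<le> n"
    using closed_adj_power_imp_awalk assms by blast
  then have "gdist G u v \<le> ereal (real (length p))"
    using min_cost_le_walk_cost[of u p v "\<lambda>_. 1"] by (simp add: gdist_def awalk_cost_one)
  also have "\<dots> \<le> ereal (real n)" using p by simp
  finally show "gdist G u v \<le> ereal (real n)" .
qed

end

section \<open>Counting pairs of vertices by spheres and by balls\<close>

definition ball_verts :: "'a pair_pre_digraph \<Rightarrow> nat \<Rightarrow> 'a \<Rightarrow> 'a set" where
  "ball_verts G n u = {v \<in> pverts G. gdist G u v \<le> ereal (real n)}"

definition sphere_pairs :: "'a pair_pre_digraph \<Rightarrow> nat \<Rightarrow> nat \<Rightarrow> nat \<Rightarrow> 'a \<Rightarrow> nat" where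
  "sphere_pairs G h i j u = (\<Sum>v\<in>Gam G h u. card (Gam G i u \<inter> Gam G j v))"

definition ball_pairs :: "'a pair_pre_digraph \<Rightarrow> nat \<Rightarrow> nat \<Rightarrow> nat \<Rightarrow> 'a \<Rightarrow> nat" where
  "ball_pairs G h i j u = (\<Sum>v\<in>ball_verts G h u. card (ball_verts G i u \<inter> ball_verts G j v))"

lemma Gam_disjoint: "a \<noteq> b \<Longrightarrow> Gam G a u \<inter> Gam G b u = {}"
  by (auto simp: Gam_def)

lemma Gam_empty_beyond_diam:
  assumes "\<not> ereal (real n) \<le> diam G" "u \<in> pverts G"
  shows "Gam G n u = {}"
proof -
  have "gdist G u v \<le> diam G" if "v \<in> pverts G" for v
    unfolding diam_def using assms(2) that by (meson SUP_upper2 SUP_upper)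
  with assms(1) show ?thesis by (force simp: Gam_def)
qed

context pair_fin_digraph begin

lemma finite_Gam: "finite (Gam G n u)"
  using pair_finite_verts by (simp add: Gam_def)

lemma finite_ball_verts: "finite (ball_verts G n u)"
  using pair_finite_verts by (simp add: ball_verts_def)

lemma ball_verts_eq_UN_Gam: "ball_verts G n u = (\<Union>k\<le>n. Gam G k u)"
  by (auto simp: ball_verts_def Gam_def elim: gdist_le_imp_nat)

lemma Gam_0:
  assumes "u \<in> pverts G"
  shows "Gam G 0 u = {u}"
proof -
  have "Gam G 0 u = ball_verts G 0 u" by (simp add: ball_verts_eq_UN_Gam)
  also have "\<dots> = {u}"
    using assms gdist_le_iff_closed_adj_power[OF assms, of _ 0] by (auto simp: ball_verts_def)
  finally show ?thesis .
qed

lemma centre_in_ball_verts: "u \<in> pverts G \<Longrightarrow> u \<in> ball_verts G n u"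
  using Gam_0 by (auto simp: ball_verts_eq_UN_Gam)

lemma ball_pairs_pos:
  assumes "u \<in> pverts G"
  shows "ball_pairs G h i j u > 0"
proof -
  have "u \<in> ball_verts G i u \<inter> ball_verts G j u"
    using assms by (simp add: centre_in_ball_verts)
  then have "card (ball_verts G i u \<inter> ball_verts G j u) > 0"
    using finite_ball_verts card_gt_0_iff by blast
  then show ?thesis
    unfolding ball_pairs_def
    using assms by (intro sum_pos2[of _ u]) (auto simp: centre_in_ball_verts finite_ball_verts)
qed

lemma ball_pairs_eq_sum_sphere_pairs:
  "ball_pairs G h i j u = (\<Sum>a\<le>h. \<Sum>b\<le>i. \<Sum>c\<le>j. sphere_pairs G a b c u)"
proof -
  have card_inter: "card (ball_verts G i u \<inter> ball_verts G j v)
      = (\<Sum>b\<le>i. \<Sum>c\<le>j. card (Gam G b u \<inter> Gam G c v))" for v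
  proof -
    have "card (ball_verts G i u \<inter> ball_verts G j v)
        = card (\<Union>b\<le>i. \<Union>c\<le>j. Gam G b u \<inter> Gam G c v)"
      by (rule arg_cong[of _ _ card]) (auto simp: ball_verts_eq_UN_Gam)
    also have "\<dots> = (\<Sum>b\<le>i. card (\<Union>c\<le>j. Gam G b u \<inter> Gam G c v))"
      using Gam_disjoint[of _ _ G u] finite_Gam by (intro card_UN_disjoint) auto
    also have "\<dots> = (\<Sum>b\<le>i. \<Sum>c\<le>j. card (Gam G b u \<inter> Gam G c v))"
      using Gam_disjoint[of _ _ G v] finite_Gam
      by (intro sum.cong refl card_UN_disjoint) auto
    finally show ?thesis .
  qed
  have "ball_pairs G h i j u
      = (\<Sum>a\<le>h. \<Sum>v\<in>Gam G a u. \<Sum>b\<le>i. \<Sum>c\<le>j. card (Gam G b u \<inter> Gam G c v))"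
    unfolding ball_pairs_def card_inter ball_verts_eq_UN_Gam[of h]
    using Gam_disjoint[of _ _ G u] finite_Gam by (intro sum.UNION_disjoint) auto
  also have "\<dots> = (\<Sum>a\<le>h. \<Sum>b\<le>i. \<Sum>v\<in>Gam G a u. \<Sum>c\<le>j. card (Gam G b u \<inter> Gam G c v))"
    by (intro sum.cong refl sum.swap)
  also have "\<dots> = (\<Sum>a\<le>h. \<Sum>b\<le>i. \<Sum>c\<le>j. sphere_pairs G a b c u)"
    unfolding sphere_pairs_def by (intro sum.cong refl sum.swap)
  finally show ?thesis .
qed

lemma mean_intersection_0:
  assumes "u \<in> pverts G"
  shows "mean_intersection G 0 i i u = real (card (Gam G i u))"
  using assms by (simp add: mean_intersection_def Gam_0)

lemma sphere_pairs_0: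
  assumes "u \<in> pverts G"
  shows "sphere_pairs G 0 h h u = card (Gam G h u)"
  using assms by (simp add: sphere_pairs_def Gam_0)

lemma mean_intersection_eq:
  "mean_intersection G h i j u = real (sphere_pairs G h i j u) / real (card (Gam G h u))"
  by (simp add: mean_intersection_def sphere_pairs_def)

lemma sphere_pairs_eq:
  "real (sphere_pairs G h i j u) = mean_intersection G h i j u * real (card (Gam G h u))"
  by (cases "Gam G h u = {}")
    (auto simp: mean_intersection_eq finite_Gam, simp add: sphere_pairs_def)

lemma sphere_pairs_beyond_diam:
  assumes "u \<in> pverts G"
    and "\<not> (ereal (real h) \<le> diam G \<and> ereal (real i) \<le> diam G \<and> ereal (real j) \<le> diam G)"
  shows "sphere_pairs G h i j u = 0"
proof -
  have "Gam G h u = {} \<or> Gam G i u = {} \<or> (\<forall>v\<in>pverts G. Gam G j v = {})"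
    using assms Gam_empty_beyond_diam by metis
  then show ?thesis by (auto simp: sphere_pairs_def Gam_def)
qed

text \<open>
  The number of pairs is the mean times the size of \<open>Gam G h u\<close>, so constant sphere sizes let one
  pass between the two.  The sizes themselves are both the means and the pair
  counts for \<open>(0, h, h)\<close>.
\<close>

lemma dmr_iff_sphere_pairs:
  "dmr G \<longleftrightarrow> (\<forall>h i j. \<forall>u\<in>pverts G. \<forall>v\<in>pverts G. sphere_pairs G h i j u = sphere_pairs G h i j v)"
proof
  assume dmr: "dmr G"
  show "\<forall>h i j. \<forall>u\<in>pverts G. \<forall>v\<in>pverts G. sphere_pairs G h i j u = sphere_pairs G h i j v"
  proof (intro allI ballI)
    fix h i j u v assume uv: "u \<in> pverts G" "v \<in> pverts G"
    show "sphere_pairs G h i j u = sphere_pairs G h i j v"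
    proof (cases "ereal (real h) \<le> diam G \<and> ereal (real i) \<le> diam G \<and> ereal (real j) \<le> diam G")
      case True
      have "ereal (real 0) \<le> diam G"
        using Gam_empty_beyond_diam[of 0 G u] Gam_0[of u] uv by auto
      then have "mean_intersection G 0 h h u = mean_intersection G 0 h h v"
        using dmr True uv unfolding dmr_def by blast
      then have "card (Gam G h u) = card (Gam G h v)"
        using uv by (simp add: mean_intersection_0)
      moreover have "mean_intersection G h i j u = mean_intersection G h i j v"
        using dmr True uv unfolding dmr_def by blast
      ultimately have "real (sphere_pairs G h i j u) = real (sphere_pairs G h i j v)"
        by (simp add: sphere_pairs_eq)
      then show ?thesis by simp
    next
      case False
      then show ?thesis using uv by (simp add: sphere_pairs_beyond_diam)
    qed
  qed
next
  assume const: "\<forall>h i j. \<forall>u\<in>pverts G. \<forall>v\<in>pverts G. sphere_pairs G h i j u = sphere_pairs G h i j v"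
  have "mean_intersection G h i j u = mean_intersection G h i j v"
    if "u \<in> pverts G" "v \<in> pverts G" for h i j u v
  proof -
    have "card (Gam G h u) = card (Gam G h v)"
      using const that sphere_pairs_0 by metis
    moreover have "sphere_pairs G h i j u = sphere_pairs G h i j v"
      using const that by blast
    ultimately show ?thesis by (simp add: mean_intersection_eq)
  qed
  then show "dmr G" unfolding dmr_def by blast
qed

end

lemma partial_sums_determine:
  fixes f g :: "nat \<Rightarrow> 'c::cancel_comm_monoid_add"
  assumes "\<And>n. (\<Sum>k\<le>n. f k) = (\<Sum>k\<le>n. g k)"
  shows "f n = g n"
proof (cases n)
  case 0
  then show ?thesis using assms[of 0] by simp
next
  case (Suc m)
  then show ?thesis using assms[of m] assms[of n] by simp
qed

text \<open>The radii are peeled off one at a time, treating the remaining inner sums as single terms.\<close>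

lemma triple_partial_sums_determine:
  fixes f g :: "nat \<Rightarrow> nat \<Rightarrow> nat \<Rightarrow> 'c::cancel_comm_monoid_add"
  assumes "\<And>h i j. (\<Sum>a\<le>h. \<Sum>b\<le>i. \<Sum>c\<le>j. f a b c) = (\<Sum>a\<le>h. \<Sum>b\<le>i. \<Sum>c\<le>j. g a b c)"
  shows "f h i j = g h i j"
proof -
  have "(\<Sum>b\<le>i. \<Sum>c\<le>j. f h b c) = (\<Sum>b\<le>i. \<Sum>c\<le>j. g h b c)" for h i j
    using assms by (rule partial_sums_determine)
  then have "(\<Sum>c\<le>j. f h i c) = (\<Sum>c\<le>j. g h i c)" for h i j
    by (rule partial_sums_determine)
  then show ?thesis by (rule partial_sums_determine)
qed

lemma (in pair_fin_digraph) dmr_iff_ball_pairs: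
  "dmr G \<longleftrightarrow> (\<forall>h i j. \<forall>u\<in>pverts G. \<forall>v\<in>pverts G. ball_pairs G h i j u = ball_pairs G h i j v)"
proof
  assume "dmr G"
  then have "sphere_pairs G h i j u = sphere_pairs G h i j v"
    if "u \<in> pverts G" "v \<in> pverts G" for h i j u v
    using that unfolding dmr_iff_sphere_pairs by blast
  then show "\<forall>h i j. \<forall>u\<in>pverts G. \<forall>v\<in>pverts G. ball_pairs G h i j u = ball_pairs G h i j v"
    unfolding ball_pairs_eq_sum_sphere_pairs by (intro allI ballI sum.cong refl)
next
  assume const: "\<forall>h i j. \<forall>u\<in>pverts G. \<forall>v\<in>pverts G. ball_pairs G h i j u = ball_pairs G h i j v"
  have "sphere_pairs G h i j u = sphere_pairs G h i j v"
    if "u \<in> pverts G" "v \<in> pverts G" for h i j u v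
  proof (rule triple_partial_sums_determine[of
        "\<lambda>a b c. sphere_pairs G a b c u" "\<lambda>a b c. sphere_pairs G a b c v"])
    show "(\<Sum>a\<le>h. \<Sum>b\<le>i. \<Sum>c\<le>j. sphere_pairs G a b c u)
        = (\<Sum>a\<le>h. \<Sum>b\<le>i. \<Sum>c\<le>j. sphere_pairs G a b c v)" for h i j
      using const that unfolding ball_pairs_eq_sum_sphere_pairs by blast
  qed
  then show "dmr G" unfolding dmr_iff_sphere_pairs by blast
qed

section \<open>Balls of the strong product\<close>

lemma closed_adj_strong_product:
  assumes "pair_wf_digraph G" "pair_wf_digraph H"
  shows "((g, x), (g', x')) \<in> closed_adj (strong_product G H)
    \<longleftrightarrow> (g, g') \<in> closed_adj G \<and> (x, x') \<in> closed_adj H"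
proof -
  interpret G: pair_wf_digraph G by fact
  interpret H: pair_wf_digraph H by fact
  show ?thesis
    by (auto simp: closed_adj_def strong_product_def
        dest: G.in_arcsD1 G.in_arcsD2 H.in_arcsD1 H.in_arcsD2)
qed

lemma closed_adj_power_strong_product:
  assumes "pair_wf_digraph G" "pair_wf_digraph H"
  shows "((g, x), (g', x')) \<in> closed_adj (strong_product G H) ^^ n
    \<longleftrightarrow> (g, g') \<in> closed_adj G ^^ n \<and> (x, x') \<in> closed_adj H ^^ n"
proof (induct n arbitrary: g' x')
  case 0
  then show ?case by auto
next
  case (Suc n)
  then show ?case
    by (auto simp: relcomp_unfold closed_adj_strong_product[OF assms])
qed

lemma ball_verts_strong_product:
  assumes "pair_graph G" "pair_graph H" "g \<in> pverts G" "x \<in> pverts H"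
  shows "ball_verts (strong_product G H) n (g, x) = ball_verts G n g \<times> ball_verts H n x"
proof -
  interpret G: pair_graph G by fact
  interpret H: pair_graph H by fact
  interpret P: pair_graph "strong_product G H"
    using assms by (intro pair_graph_strong_product)
  have verts: "pverts (strong_product G H) = pverts G \<times> pverts H"
    by (simp add: strong_product_def)
  have "gdist (strong_product G H) (g, x) (g', x') \<le> ereal (real n)
      \<longleftrightarrow> gdist G g g' \<le> ereal (real n) \<and> gdist H x x' \<le> ereal (real n)" for g' x'
    using assms(3,4)
    by (simp add: verts P.gdist_le_iff_closed_adj_power G.gdist_le_iff_closed_adj_power
        H.gdist_le_iff_closed_adj_power
        closed_adj_power_strong_product[OF G.pair_wf_digraph H.pair_wf_digraph])
  then show ?thesis by (auto simp: ball_verts_def verts)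
qed

lemma ball_pairs_strong_product:
  assumes "pair_graph G" "pair_graph H" "g \<in> pverts G" "x \<in> pverts H"
  shows "ball_pairs (strong_product G H) h i j (g, x) = ball_pairs G h i j g * ball_pairs H h i j x"
proof -
  have "ball_pairs (strong_product G H) h i j (g, x)
      = (\<Sum>(v, y)\<in>ball_verts G h g \<times> ball_verts H h x.
          card (ball_verts G i g \<inter> ball_verts G j v) * card (ball_verts H i x \<inter> ball_verts H j y))"
    unfolding ball_pairs_def ball_verts_strong_product[OF assms]
    by (intro sum.cong refl)
      (auto simp: ball_verts_strong_product[OF assms(1,2)] Times_Int_Times card_cartesian_product
        ball_verts_def[of G h] ball_verts_def[of H h])
  also have "\<dots> = ball_pairs G h i j g * ball_pairs H h i j x"
    by (simp add: ball_pairs_def sum_product sum.cartesian_product)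
  finally show ?thesis .
qed

section \<open>Factors of a DMR strong product\<close>

theorem theorem3p13:
  fixes G :: "'a pair_pre_digraph" and H :: "'b pair_pre_digraph"
  assumes "pair_graph G" and "Digraph_Component.connected (with_proj G)"
    and "pair_graph H" and "Digraph_Component.connected (with_proj H)"
    and "dmr (strong_product G H)"
  shows "dmr G \<and> dmr H"
proof -
  interpret G: pair_graph G by fact
  interpret H: pair_graph H by fact
  interpret P: pair_graph "strong_product G H"
    using assms by (intro pair_graph_strong_product)
  \<comment> \<open>Connected graphs are nonempty; without a vertex in \<open>H\<close> the product would say nothing about \<open>G\<close>.\<close>
  obtain g0 x0 where base: "g0 \<in> pverts G" "x0 \<in> pverts H"
    using assms(2,4) by (auto simp: Digraph_Component.connected_def strongly_connected_def)
  have const: "ball_pairs G h i j g * ball_pairs H h i j x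
      = ball_pairs G h i j g' * ball_pairs H h i j x'"
    if "g \<in> pverts G" "g' \<in> pverts G" "x \<in> pverts H" "x' \<in> pverts H" for h i j g g' x x'
  proof -
    have "(g, x) \<in> pverts (strong_product G H)" "(g', x') \<in> pverts (strong_product G H)"
      using that by (auto simp: strong_product_def)
    then have "ball_pairs (strong_product G H) h i j (g, x)
        = ball_pairs (strong_product G H) h i j (g', x')"
      using assms(5) P.dmr_iff_ball_pairs by blast
    then show ?thesis
      using that by (simp add: ball_pairs_strong_product assms(1,3))
  qed
  have "ball_pairs G h i j g = ball_pairs G h i j g'"
    if "g \<in> pverts G" "g' \<in> pverts G" for h i j g g'
    using const[OF that base(2) base(2), of h i j]
      H.ball_pairs_pos[OF base(2), of h i j] by simp
  moreover have "ball_pairs H h i j x = ball_pairs H h i j x'"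
    if "x \<in> pverts H" "x' \<in> pverts H" for h i j x x'
    using const[OF base(1) base(1) that, of h i j]
      G.ball_pairs_pos[OF base(1), of h i j] by simp
  ultimately show ?thesis
    unfolding G.dmr_iff_ball_pairs H.dmr_iff_ball_pairs by blast
qed

end
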